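(* Let $\mathcal{H}$ be a complex Hilbert space, $d\in\mathbb{N}$, and let $\mathbf{T}=(T_1,\ldots,T_d)\in\mathfrak{B}(\mathcal{H})^d$ be a subnormal $d$-tuple. If $\mathbf{T}^n$ is spherically quasinormal for some $n\in\mathbb{N}$, then $\mathbf{T}$ is also spherically quasinormal.
   Context: $\mathfrak{B}(\mathcal{H})$ is the algebra of bounded linear operators on $\mathcal{H}$; $\mathbb{N}=\{1,2,\ldots\}$. An $m$-tuple $\mathbf{A}=(A_1,\ldots,A_m)\in\mathfrak{B}(\mathcal{H})^m$ is spherically quasinormal if each $A_i$, $i\in\{1,\ldots,m\}$, commutes with $\sum_{j=1}^mA_j^*A_j$. A $d$-tuple $\mathbf{N}=(N_1,\ldots,N_d)$ is normal if it is commuting and each $N_k$ is normal. $\mathbf{T}\in\mathfrak{B}(\mathcal{H})^d$ is subnormal if there exist a Hilbert space $\mathcal{K}\supseteq\mathcal{H}$ and a normal $d$-tuple $\mathbf{N}\in\mathfrak{B}(\mathcal{K})^d$ such that $N_k\mathcal{H}\subseteq\mathcal{H}$ and $N_k|_{\mathcal{H}}=T_k$ for every $k$. For $\mathbf{T}=(T_1,\ldots,T_m)\in\mathfrak{B}(\mathcal{H})^m$ and $\mathbf{S}=(S_1,\ldots,S_n)\in\mathfrak{B}(\mathcal{H})^n$, let $\mathbf{T}\circ\mathbf{S}=(T_1S_1,\ldots,T_1S_n,\ldots,T_mS_1,\ldots,T_mS_n)$, an $mn$-tuple. Powers are defined by $\mathbf{T}^1=\mathbf{T}$ and $\mathbf{T}^{n+1}=\mathbf{T}\circ\mathbf{T}^n$;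 thus for a $d$-tuple $\mathbf{T}$, $\mathbf{T}^n$ is the $d^n$-tuple of all products $T_{i_1}\cdots T_{i_n}$. *)

theory Defs
  imports "HOL-Analysis.Analysis"
begin

(* A complex inner product space is presented on top of the library class real_inner: the real
   inner product is the real part of the complex one, and scaleR is scaleC restricted to the reals.
   Hence norm, metric and positive definiteness are those of cinner, see cinner_self below.
   The inner product is linear in its first argument. *)
class complex_inner = real_inner +
  fixes scaleC :: "complex \<Rightarrow> 'a \<Rightarrow> 'a" (infixr \<open>*\<^sub>C\<close> 75)
    and cinner :: "'a \<Rightarrow> 'a \<Rightarrow> complex"
  assumes scaleC_add_right: "a *\<^sub>C (x + y) = a *\<^sub>C x + a *\<^sub>C y"
    and scaleC_add_left: "(a + b) *\<^sub>C x = a *\<^sub>C x + b *\<^sub>C x"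
    and scaleC_scaleC: "a *\<^sub>C (b *\<^sub>C x) = (a * b) *\<^sub>C x"
    and scaleR_scaleC: "r *\<^sub>R x = complex_of_real r *\<^sub>C x"
    and cinner_commute: "cinner x y = cnj (cinner y x)"
    and cinner_add_left: "cinner (x + y) z = cinner x z + cinner y z"
    and cinner_scaleC_left: "cinner (a *\<^sub>C x) y = a * cinner x y"
    and inner_eq_Re_cinner: "inner x y = Re (cinner x y)"

class chilbert_space = complex_inner + complete_space

lemma cinner_self: "cinner x x = complex_of_real ((norm x)\<^sup>2)"
proof -
  have "Im (cinner x x) = 0"
    using arg_cong[OF cinner_commute[of x x], of Im] by simp
  moreover have "Re (cinner x x) = (norm x)\<^sup>2"
    by (simp add: power2_norm_eq_inner inner_eq_Re_cinner)
  ultimately show ?thesis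
    by (simp add: complex_eq_iff)
qed

instantiation complex :: chilbert_space
begin

definition scaleC_complex :: "complex \<Rightarrow> complex \<Rightarrow> complex"
  where "scaleC_complex a x = a * x"

definition cinner_complex :: "complex \<Rightarrow> complex \<Rightarrow> complex"
  where "cinner_complex x y = x * cnj y"

instance
  by standard
    (auto simp: scaleC_complex_def cinner_complex_def algebra_simps scaleR_conv_of_real
      inner_complex_def)

end

definition bounded_clinear :: "('a::complex_inner \<Rightarrow> 'b::complex_inner) \<Rightarrow> bool"
  where "bounded_clinear f \<longleftrightarrow> bounded_linear f \<and> (\<forall>c x. f (c *\<^sub>C x) = c *\<^sub>C f x)"

(* For A bounded on a Hilbert space the description is proper, see cinner_cadjoint below. *)
definition cadjoint :: "('a::chilbert_space \<Rightarrow> 'a) \<Rightarrow> 'a \<Rightarrow> 'a"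
  where "cadjoint A = (THE B. \<forall>x y. cinner (A x) y = cinner x (B y))"

lemma riesz_representation_inner:
  fixes f :: "'a::{real_inner, complete_space} \<Rightarrow> real"
  assumes "bounded_linear f"
  shows "\<exists>z. \<forall>x. f x = inner x z"
proof -
  interpret f: bounded_linear f by fact
  obtain K where K: "\<And>x. \<bar>f x\<bar> \<le> norm x * K"
    using f.bounded by (metis real_norm_def)
  define J where "J x = (norm x)\<^sup>2 - 2 * f x" for x
  have lb: "- K\<^sup>2 \<le> J x" for x
  proof -
    have "0 \<le> (norm x - K)\<^sup>2" by simp
    then show ?thesis
      using K[of x] by (simp add: J_def power2_diff)
  qed
  define m where "m = Inf (range J)"
  have bdd: "bdd_below (range J)"
    using lb by (auto simp: bdd_below_def)
  have m: "m \<le> J x" for x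
    unfolding m_def by (intro cInf_lower bdd) auto
  have "\<exists>x. J x < m + 1 / real (Suc k)" for k
    using cInf_lessD[of "range J" "m + 1 / real (Suc k)"] by (auto simp: m_def)
  then obtain X where X: "\<And>k. J (X k) < m + 1 / real (Suc k)"
    by metis
  have par: "(norm (x - y))\<^sup>2 = 2 * J x + 2 * J y - 4 * J ((1/2) *\<^sub>R (x + y))" for x y
    by (simp add: J_def f.scaleR f.add power2_norm_eq_inner algebra_simps inner_commute)
  have dist: "(norm (X k - X l))\<^sup>2 \<le> 2 * (1 / real (Suc k)) + 2 * (1 / real (Suc l))" for k l
    using par[of "X k" "X l"] X[of k] X[of l] m[of "(1/2) *\<^sub>R (X k + X l)"] by linarith
  have "Cauchy X"
  proof (rule metric_CauchyI)
    fix e :: real assume e: "e > 0"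
    obtain M :: nat where M: "4 / e\<^sup>2 < real M"
      using reals_Archimedean2 by blast
    have "dist (X k) (X l) < e" if "k \<ge> M" "l \<ge> M" for k l
    proof -
      have pos: "0 < real M" using M e by (smt (verit) divide_pos_pos zero_less_power)
      have "(norm (X k - X l))\<^sup>2 \<le> 2 * (1 / real (Suc k)) + 2 * (1 / real (Suc l))"
        by (rule dist)
      also have "\<dots> \<le> 2 * (1 / real M) + 2 * (1 / real M)"
        using that pos by (intro add_mono mult_left_mono divide_left_mono) auto
      also have "\<dots> < e\<^sup>2"
        using M e pos by (simp add: field_simps)
      finally show ?thesis
        using e by (simp add: dist_norm power2_less_imp_less)
    qed
    then show "\<exists>M. \<forall>k\<ge>M. \<forall>l\<ge>M. dist (X k) (X l) < e" by blast
  qed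
  then obtain z where z: "X \<longlonglongrightarrow> z"
    using Cauchy_convergent convergent_def by blast
  have "(\<lambda>k. J (X k)) \<longlonglongrightarrow> J z"
    unfolding J_def by (intro tendsto_intros f.tendsto z)
  moreover have "(\<lambda>k. m + 1 / real (Suc k)) \<longlonglongrightarrow> m + 0"
    by (intro tendsto_intros LIMSEQ_Suc lim_1_over_n)
  ultimately have "J z \<le> m + 0"
    using X by (meson LIMSEQ_le less_imp_le)
  then have min: "J z \<le> J x" for x
    using m[of x] by simp
  have "f x = inner x z" for x
  proof (rule ccontr)
    assume "f x \<noteq> inner x z"
    define b where "b = f x - inner x z"
    define t where "t = b / ((norm x)\<^sup>2 + 1)"
    have pos: "(norm x)\<^sup>2 + 1 > 0" by (smt (verit) zero_le_power2)
    have "b \<noteq> 0" using \<open>f x \<noteq> inner x z\<close> by (simp add: b_def)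
    have "J (z + t *\<^sub>R x) = J z + t\<^sup>2 * (norm x)\<^sup>2 - 2 * t * b"
      by (simp add: J_def b_def f.scaleR f.add power2_norm_eq_inner algebra_simps inner_commute
          power2_eq_square[of t])
    then have "2 * t * b \<le> t\<^sup>2 * (norm x)\<^sup>2"
      using min[of "z + t *\<^sub>R x"] by simp
    also have "\<dots> \<le> t\<^sup>2 * ((norm x)\<^sup>2 + 1)"
      by (intro mult_left_mono) auto
    also have "\<dots> = t * b"
      using pos by (simp add: t_def power2_eq_square)
    finally have "t * b \<le> 0" by (simp add: mult.commute)
    moreover have "t * b > 0"
      using pos \<open>b \<noteq> 0\<close> by (simp add: t_def flip: power2_eq_square)
    ultimately show False by simp
  qed
  then show ?thesis by blast
qed

lemma cinner_eq_inner: "cinner x y = Complex (inner x y) (- inner (\<i> *\<^sub>C x) y)"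
  by (simp add: inner_eq_Re_cinner cinner_scaleC_left complex_eq_iff)

lemma cinner_cadjoint:
  assumes "bounded_clinear A"
  shows "cinner (A x) y = cinner x (cadjoint A y)"
proof -
  have A: "bounded_linear A" "\<And>c x. A (c *\<^sub>C x) = c *\<^sub>C A x"
    using assms by (auto simp: bounded_clinear_def)
  have "bounded_linear (\<lambda>x. inner (A x) y)" for y
    using bounded_linear_compose[OF bounded_linear_inner_left A(1)] .
  then have "\<forall>y. \<exists>z. \<forall>x. inner (A x) y = inner x z"
    using riesz_representation_inner by blast
  then obtain B where B: "\<And>x y. inner (A x) y = inner x (B y)"
    by metis
  have B': "\<forall>x y. cinner (A x) y = cinner x (B y)"
    unfolding cinner_eq_inner A(2)[symmetric] B by simp
  moreover have "C = B" if "\<forall>x y. cinner (A x) y = cinner x (C y)" for C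
  proof
    fix y
    have "inner x (C y) = inner x (B y)" for x
      using that B' by (simp add: inner_eq_Re_cinner)
    then show "C y = B y" by (metis vector_eq_ldot)
  qed
  ultimately have "\<forall>x y. cinner (A x) y = cinner x (cadjoint A y)"
    unfolding cadjoint_def by (rule theI)
  then show ?thesis by blast
qed

definition spherically_quasinormal :: "('a::chilbert_space \<Rightarrow> 'a) list \<Rightarrow> bool"
  where "spherically_quasinormal As \<longleftrightarrow>
    (let Q = (\<lambda>x. \<Sum>A\<leftarrow>As. cadjoint A (A x)) in \<forall>A\<in>set As. A \<circ> Q = Q \<circ> A)"

definition normal_operator :: "('a::chilbert_space \<Rightarrow> 'a) \<Rightarrow> bool"
  where "normal_operator N \<longleftrightarrow> bounded_clinear N \<and> N \<circ> cadjoint N = cadjoint N \<circ> N"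

definition normal_tuple :: "('a::chilbert_space \<Rightarrow> 'a) list \<Rightarrow> bool"
  where "normal_tuple Ns \<longleftrightarrow>
    (\<forall>M\<in>set Ns. \<forall>N\<in>set Ns. M \<circ> N = N \<circ> M) \<and> (\<forall>N\<in>set Ns. normal_operator N)"

(* The larger Hilbert space is the type 'k, with the space of Ts embedded by a complex-linear
   isometry V. The equation N (V h) = V (T h) says both that the range of V is invariant under N
   and that N restricts to T there. HOL cannot quantify existentially over types, so 'k is a
   parameter; a theorem having subnormal_tuple TYPE('k) Ts as a hypothesis, with 'k a type
   variable, covers extensions to arbitrary Hilbert spaces. *)
definition subnormal_tuple ::
    "'k::chilbert_space itself \<Rightarrow> ('h::chilbert_space \<Rightarrow> 'h) list \<Rightarrow> bool"
  where "subnormal_tuple (_ :: 'k itself) Ts \<longleftrightarrow>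
    (\<exists>(V :: 'h \<Rightarrow> 'k) (Ns :: ('k \<Rightarrow> 'k) list).
      bounded_clinear V \<and> (\<forall>x y. cinner (V x) (V y) = cinner x y) \<and>
      length Ns = length Ts \<and> normal_tuple Ns \<and>
      (\<forall>k<length Ts. \<forall>h. (Ns ! k) (V h) = V ((Ts ! k) h)))"

definition tuple_comp :: "('a \<Rightarrow> 'a) list \<Rightarrow> ('a \<Rightarrow> 'a) list \<Rightarrow> ('a \<Rightarrow> 'a) list"
  where "tuple_comp Ts Ss = [T \<circ> S. T \<leftarrow> Ts, S \<leftarrow> Ss]"

(* Only exponents n >= 1 are meaningful for the theory; the value at 0 is chosen such that the
   first power is Ts, see tuple_power_1. *)
primrec tuple_power :: "('a \<Rightarrow> 'a) list \<Rightarrow> nat \<Rightarrow> ('a \<Rightarrow> 'a) list"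
  where
    "tuple_power Ts 0 = [id]"
  | "tuple_power Ts (Suc n) = tuple_comp Ts (tuple_power Ts n)"

lemma tuple_power_1: "tuple_power Ts 1 = Ts"
  by (simp add: tuple_comp_def)

end

theory Submission
  imports Defs "HOL-Complex_Analysis.Complex_Analysis" "HOL-Real_Asymp.Real_Asymp"
    "HOL-Computational_Algebra.Fundamental_Theorem_Algebra"
begin

text \<open>
  Let \<open>N\<close> be a normal extension of \<open>T\<close> along the isometry \<open>V\<close>, put \<open>M = \<Sum> N\<^sub>j\<^sup>* N\<^sub>j\<close>, and let \<open>Q\<close> be the
  corresponding sum for the \<open>n\<close>-th power of \<open>T\<close>. By Fuglede's theorem every \<open>N\<^sub>i\<close> commutes with \<open>M\<close>, so
  the sum for the \<open>n\<close>-th power of \<open>N\<close> is the operator power \<open>M\<^sup>n\<close> and \<open>Q = V\<^sup>* M\<^sup>n V\<close>. Spherical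
  quasinormality of the \<open>n\<close>-th power of \<open>T\<close> gives \<open>Q\<^sup>2 = V\<^sup>* M\<^sup>2\<^sup>n V\<close>, hence \<open>\<parallel>M\<^sup>n V x\<parallel> = \<parallel>Q x\<parallel>\<close>, which
  forces \<open>M\<^sup>n V = V Q\<close>. Since \<open>M\<close> is a norm limit of polynomials in \<open>M\<^sup>n\<close>, it also leaves the range of
  \<open>V\<close> invariant. So the sum for \<open>T\<close> is the restriction of \<open>M\<close>, and it commutes with the restrictions
  \<open>T\<^sub>i\<close> of the \<open>N\<^sub>i\<close>.
\<close>

section \<open>Complex inner product spaces and bounded operators\<close>

lemma cinner_add_right: "cinner x (y + z) = cinner x y + cinner x z"
  by (metis cinner_add_left cinner_commute complex_cnj_add)

lemma cinner_scaleC_right: "cinner x (a *\<^sub>C y) = cnj a * cinner x y"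
  by (metis cinner_commute cinner_scaleC_left complex_cnj_mult)

lemma scaleC_zero_left [simp]: "0 *\<^sub>C (x::'a::complex_inner) = 0"
  using scaleC_add_left[of 0 0 x] by simp

lemma scaleC_zero_right [simp]: "a *\<^sub>C (0::'a::complex_inner) = 0"
  using scaleC_add_right[of a 0 "0::'a"] by simp

lemma scaleC_one [simp]: "1 *\<^sub>C (x::'a::complex_inner) = x"
  using scaleR_scaleC[of 1 x] by simp

lemma scaleC_minus_left: "(- a) *\<^sub>C (x::'a::complex_inner) = - (a *\<^sub>C x)"
  using scaleC_add_left[of a "- a" x] by (simp add: eq_neg_iff_add_eq_0 add.commute)

lemma scaleC_minus_right: "a *\<^sub>C (- x::'a::complex_inner) = - (a *\<^sub>C x)"
  using scaleC_add_right[of a x "- x"] by (simp add: eq_neg_iff_add_eq_0 add.commute)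

lemma scaleC_diff_right: "a *\<^sub>C (x - y::'a::complex_inner) = a *\<^sub>C x - a *\<^sub>C y"
  using scaleC_add_right[of a x "- y"] by (simp add: scaleC_minus_right)

lemma cinner_zero_left [simp]: "cinner 0 y = 0"
  using cinner_add_left[of 0 0 y] by simp

lemma cinner_zero_right [simp]: "cinner x 0 = 0"
  using cinner_add_right[of x 0 0] by simp

lemma cinner_minus_left: "cinner (- x) y = - cinner x y"
  using cinner_add_left[of x "- x" y] by (simp add: eq_neg_iff_add_eq_0 add.commute)

lemma cinner_minus_right: "cinner x (- y) = - cinner x y"
  using cinner_add_right[of x y "- y"] by (simp add: eq_neg_iff_add_eq_0 add.commute)

lemma cinner_diff_left: "cinner (x - y) z = cinner x z - cinner y z"
  using cinner_add_left[of x "- y" z] by (simp add: cinner_minus_left)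

lemma cinner_diff_right: "cinner x (y - z) = cinner x y - cinner x z"
  using cinner_add_right[of x y "- z"] by (simp add: cinner_minus_right)

lemma cinner_sum_list_left: "cinner (\<Sum>a\<leftarrow>xs. f a) y = (\<Sum>a\<leftarrow>xs. cinner (f a) y)"
  by (induction xs) (auto simp: cinner_add_left)

lemma cinner_ext:
  assumes "\<And>y. cinner x y = cinner x' y"
  shows "x = x'"
proof -
  have "cinner (x - x') (x - x') = 0"
    using assms by (simp add: cinner_diff_left)
  then show ?thesis by (simp add: cinner_self)
qed

lemma norm_sq_cinner: "(complex_of_real (norm x))\<^sup>2 = cinner x x"
  by (simp add: cinner_self)

lemma norm_scaleC: "norm (a *\<^sub>C (x::'a::complex_inner)) = cmod a * norm x"
proof -
  have "complex_of_real ((norm (a *\<^sub>C x))\<^sup>2) = (a * cnj a) * complex_of_real ((norm x)\<^sup>2)"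
    by (simp add: norm_sq_cinner cinner_scaleC_left cinner_scaleC_right)
  also have "\<dots> = complex_of_real ((cmod a * norm x)\<^sup>2)"
    by (simp add: complex_norm_square[symmetric] power_mult_distrib)
  finally have "(norm (a *\<^sub>C x))\<^sup>2 = (cmod a * norm x)\<^sup>2"
    using of_real_eq_iff by blast
  then show ?thesis by (simp add: power2_eq_iff_nonneg)
qed

text \<open>Multiplying \<open>x\<close> by the phase \<open>u\<close> makes the inner product real
  and nonnegative, so the Cauchy-Schwarz inequality for \<open>inner\<close> applies.\<close>

lemma norm_cinner_le: "cmod (cinner x y) \<le> norm x * norm y"
proof (cases "cinner x y = 0")
  case False
  define u where "u = cnj (sgn (cinner x y))"
  have u: "cmod u = 1" using False by (simp add: u_def norm_sgn)
  have "complex_of_real (cmod (cinner x y)) = u * cinner x y"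
    using False
    by (simp add: u_def sgn_div_norm scaleR_conv_of_real field_simps
        complex_norm_square[symmetric] power2_eq_square flip: of_real_mult)
  then have "cmod (cinner x y) = inner (u *\<^sub>C x) y"
    by (metis Re_complex_of_real cinner_scaleC_left inner_eq_Re_cinner)
  also have "\<dots> \<le> norm (u *\<^sub>C x) * norm y" by (rule norm_cauchy_schwarz)
  finally show ?thesis using u by (simp add: norm_scaleC)
qed simp

section \<open>Bounded complex-linear maps and their adjoints\<close>

lemma bounded_clinearI:
  assumes "\<And>x y. f (x + y) = f x + f y" "\<And>c x. f (c *\<^sub>C x) = c *\<^sub>C f x"
    "\<And>x. norm (f x) \<le> norm x * K"
  shows "bounded_clinear f"
  unfolding bounded_clinear_def
proof
  show "bounded_linear f"
    by (rule bounded_linear_intro[of f K]) (simp_all add: assms scaleR_scaleC)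
qed (simp add: assms)

lemma bounded_clinearD:
  assumes "bounded_clinear f"
  shows "f (x + y) = f x + f y" "f (x - y) = f x - f y" "f (- x) = - f x" "f 0 = 0"
    "f (c *\<^sub>C x) = c *\<^sub>C f x" "bounded_linear f"
  using assms by (auto simp: bounded_clinear_def linear_simps bounded_linear.linear linear_diff)

lemma bounded_clinear_pos_bound:
  assumes "bounded_clinear f"
  obtains K where "K > 0" "\<And>x. norm (f x) \<le> K * norm x"
  using bounded_linear.pos_bounded[OF bounded_clinearD(6)[OF assms]] by (metis mult.commute)

lemma bounded_clinear_id: "bounded_clinear id" "bounded_clinear (\<lambda>x. x)"
  by (auto simp: bounded_clinear_def id_def)

lemma bounded_clinear_compose:
  assumes "bounded_clinear f" "bounded_clinear g"
  shows "bounded_clinear (f \<circ> g)"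
  using assms bounded_linear_compose by (auto simp: bounded_clinear_def o_def)

lemma bounded_clinear_add:
  assumes "bounded_clinear f" "bounded_clinear g"
  shows "bounded_clinear (\<lambda>x. f x + g x)"
  using assms bounded_linear_add by (auto simp: bounded_clinear_def scaleC_add_right)

lemma bounded_clinear_scaleC:
  assumes "bounded_clinear f"
  shows "bounded_clinear (\<lambda>x. c *\<^sub>C f x)"
proof -
  obtain K where K: "K > 0" "\<And>x. norm (f x) \<le> K * norm x"
    using bounded_clinear_pos_bound[OF assms] by blast
  show ?thesis
  proof (rule bounded_clinearI[where K = "cmod c * K"])
    show "norm (c *\<^sub>C f x) \<le> norm x * (cmod c * K)" for x
      using mult_left_mono[OF K(2)[of x], of "cmod c"] by (simp add: norm_scaleC mult_ac)
  qed (simp_all add: bounded_clinearD[OF assms] scaleC_add_right scaleC_scaleC mult.commute)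
qed

lemma bounded_clinear_sum_list:
  assumes "\<And>a. a \<in> set xs \<Longrightarrow> bounded_clinear (f a)"
  shows "bounded_clinear (\<lambda>x. \<Sum>a\<leftarrow>xs. f a x)"
  using assms
proof (induction xs)
  case Nil
  show ?case by (simp add: bounded_clinear_def)
next
  case (Cons a xs)
  then show ?case by (simp add: bounded_clinear_add)
qed

lemma bounded_clinear_funpow:
  fixes f :: "'a::complex_inner \<Rightarrow> 'a"
  assumes "bounded_clinear f"
  shows "bounded_clinear (f ^^ n)"
  by (induction n) (simp_all add: bounded_clinear_id bounded_clinear_compose[unfolded o_def] assms)

lemma funpow_norm_le:
  fixes f :: "'a::real_normed_vector \<Rightarrow> 'a"
  assumes "\<And>x. norm (f x) \<le> K * norm x" "K \<ge> 0"
  shows "norm ((f ^^ n) x) \<le> K ^ n * norm x"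
proof (induction n)
  case (Suc n)
  have "norm ((f ^^ Suc n) x) \<le> K * norm ((f ^^ n) x)" using assms by simp
  also have "\<dots> \<le> K * (K ^ n * norm x)" by (intro mult_left_mono Suc assms)
  finally show ?case by (simp add: mult_ac)
qed simp

text \<open>\<open>cadjoint\<close> covers endomorphisms, whereas the isometry of a subnormal tuple
  joins two spaces. Riesz representation for \<open>inner\<close> suffices, because
  \<open>cinner_eq_inner\<close> recovers \<open>cinner\<close> from \<open>inner\<close> and
  \<open>V\<close> respects multiplication by \<open>\<i>\<close>.\<close>

lemma adjoint_exists:
  fixes V :: "'a::chilbert_space \<Rightarrow> 'b::complex_inner"
  assumes "bounded_clinear V"
  obtains W where "\<And>x y. cinner (V x) y = cinner x (W y)"
proof -
  note V = bounded_clinearD[OF assms]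
  have "bounded_linear (\<lambda>x. inner (V x) y)" for y
    using bounded_linear_compose[OF bounded_linear_inner_left V(6)] .
  then have "\<forall>y. \<exists>z. \<forall>x. inner (V x) y = inner x z"
    using riesz_representation_inner by blast
  then obtain W where W: "\<And>x y. inner (V x) y = inner x (W y)"
    by metis
  have "cinner (V x) y = cinner x (W y)" for x y
    unfolding cinner_eq_inner V(5)[symmetric] W by simp
  then show thesis by (rule that)
qed

lemma cinner_cadjoint':
  assumes "bounded_clinear A"
  shows "cinner (cadjoint A x) y = cinner x (A y)"
  by (metis assms cinner_cadjoint cinner_commute)

lemma bounded_clinear_adjoint:
  fixes V :: "'a::complex_inner \<Rightarrow> 'b::complex_inner"
  assumes "bounded_clinear V" and W: "\<And>x y. cinner (V x) y = cinner x (W y)"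
  shows "bounded_clinear W"
proof -
  have W': "cinner (W y) x = cinner y (V x)" for x y
    by (metis W cinner_commute)
  obtain K where K: "K > 0" "\<And>x. norm (V x) \<le> K * norm x"
    using bounded_clinear_pos_bound[OF assms(1)] by blast
  show ?thesis
  proof (rule bounded_clinearI[where K = K])
    show "W (x + y) = W x + W y" for x y
      by (rule cinner_ext) (simp add: W' cinner_add_left)
    show "W (c *\<^sub>C x) = c *\<^sub>C W x" for c x
      by (rule cinner_ext) (simp add: W' cinner_scaleC_left)
    show "norm (W x) \<le> norm x * K" for x
    proof -
      have "complex_of_real ((norm (W x))\<^sup>2) = cinner x (V (W x))"
        by (simp add: W' add: norm_sq_cinner)
      then have "(norm (W x))\<^sup>2 = cmod (cinner x (V (W x)))"
        by (metis norm_of_real abs_of_nonneg zero_le_power2)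
      also have "\<dots> \<le> norm x * norm (V (W x))" by (rule norm_cinner_le)
      also have "\<dots> \<le> norm x * (K * norm (W x))" by (intro mult_left_mono K) simp
      finally have "norm (W x) * norm (W x) \<le> (norm x * K) * norm (W x)"
        by (simp add: power2_eq_square mult_ac)
      then show ?thesis using K(1)
        by (cases "norm (W x) = 0") (auto dest: mult_right_le_imp_le)
    qed
  qed
qed

lemma bounded_clinear_cadjoint: "bounded_clinear A \<Longrightarrow> bounded_clinear (cadjoint A)"
  by (rule bounded_clinear_adjoint[OF _ cinner_cadjoint])

text \<open>Gives \<open>N\<close> and its adjoint one common bound \<open>K\<close> in the
  estimates for Fuglede's theorem.\<close>

lemma cadjoint_norm_le:
  assumes "bounded_clinear A" "\<And>x. norm (A x) \<le> K * norm x"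
  shows "norm (cadjoint A x) \<le> K * norm x"
proof -
  have "complex_of_real ((norm (cadjoint A x))\<^sup>2) = cinner (A (cadjoint A x)) x"
    by (simp add: cinner_cadjoint[OF assms(1)] add: norm_sq_cinner)
  then have "(norm (cadjoint A x))\<^sup>2 = cmod (cinner (A (cadjoint A x)) x)"
    by (metis norm_of_real abs_of_nonneg zero_le_power2)
  also have "\<dots> \<le> norm (A (cadjoint A x)) * norm x" by (rule norm_cinner_le)
  also have "\<dots> \<le> (K * norm (cadjoint A x)) * norm x" by (intro mult_right_mono assms) simp
  finally have *: "norm (cadjoint A x) * norm (cadjoint A x) \<le> (K * norm x) * norm (cadjoint A x)"
    by (simp add: power2_eq_square mult_ac)
  have "0 \<le> K * norm x" using assms(2)[of x] norm_ge_zero order_trans by blast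
  with * show ?thesis
    by (cases "norm (cadjoint A x) = 0") (auto dest: mult_right_le_imp_le)
qed

section \<open>Fuglede's theorem\<close>

text \<open>With \<open>B\<close> the adjoint of \<open>N\<close>, the map \<open>z \<mapsto> (1 + z B / m)\<^sup>m A (1 - z B / m)\<^sup>m\<close> is a polynomial whose
  derivative at 0 is \<open>B A - A B\<close>. It stands in for \<open>exp (z B) A exp (- z B)\<close> in Rosenblum's proof:
  for fixed \<open>R = \<bar>z\<bar>\<close> and large \<open>m\<close> it is bounded by twice the norm of \<open>A\<close>, and the Cauchy inequality
  with \<open>R \<rightarrow> \<infinity>\<close> gives \<open>B A = A B\<close>.\<close>

definition weak_entire :: "(complex \<Rightarrow> 'a::complex_inner) \<Rightarrow> 'a \<Rightarrow> bool"
  where "weak_entire f d \<longleftrightarrow> (\<forall>y. (\<lambda>z. cinner (f z) y) holomorphic_on UNIV \<and>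
    ((\<lambda>z. cinner (f z) y) has_field_derivative cinner d y) (at 0))"

definition id_plus :: "complex \<Rightarrow> ('a::complex_inner \<Rightarrow> 'a) \<Rightarrow> 'a \<Rightarrow> 'a"
  where "id_plus a B x = x + a *\<^sub>C B x"

lemma id_plus_zero_funpow [simp]: "(id_plus 0 B ^^ k) x = x"
  by (induction k) (auto simp: id_plus_def)

lemma bounded_clinear_id_plus: "bounded_clinear B \<Longrightarrow> bounded_clinear (id_plus a B)"
  unfolding id_plus_def[abs_def] by (intro bounded_clinear_add bounded_clinear_id bounded_clinear_scaleC)

lemma weak_entire_const: "weak_entire (\<lambda>_. x) 0"
  by (simp add: weak_entire_def)

text \<open>Pairing \<open>A (f z)\<close> with \<open>y\<close> is pairing \<open>f z\<close> with
  \<open>cadjoint A y\<close>; this is why \<open>weak_entire\<close> ranges over all vectors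
  \<open>y\<close>.\<close>

lemma weak_entire_apply:
  fixes A :: "'a::chilbert_space \<Rightarrow> 'a"
  assumes "bounded_clinear A" "weak_entire f d"
  shows "weak_entire (\<lambda>z. A (f z)) (A d)"
  using assms(2) by (simp add: weak_entire_def cinner_cadjoint[OF assms(1)])

text \<open>Product rule at 0: the new factor is the identity there and has derivative
  \<open>c\<close> times \<open>B\<close>, so \<open>d\<close> survives and \<open>B (f 0)\<close>
  is added with weight \<open>c\<close>.\<close>

lemma weak_entire_id_plus:
  fixes B :: "'a::chilbert_space \<Rightarrow> 'a"
  assumes B: "bounded_clinear B" and f: "weak_entire f d"
  shows "weak_entire (\<lambda>z. id_plus (z * c) B (f z)) (d + c *\<^sub>C B (f 0))"
  unfolding weak_entire_def
proof (intro allI conjI)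
  fix y
  note eq = id_plus_def cinner_add_left cinner_scaleC_left cinner_cadjoint[OF B]
  have f': "(\<lambda>z. cinner (f z) y) holomorphic_on UNIV"
    "((\<lambda>z. cinner (f z) y) has_field_derivative cinner d y) (at 0)" for y
    using f by (auto simp: weak_entire_def)
  show "(\<lambda>z. cinner (id_plus (z * c) B (f z)) y) holomorphic_on UNIV"
    unfolding eq by (intro holomorphic_intros f')
  show "((\<lambda>z. cinner (id_plus (z * c) B (f z)) y) has_field_derivative
      cinner (d + c *\<^sub>C B (f 0)) y) (at 0)"
    unfolding eq by (auto intro!: derivative_eq_intros f')
qed

lemma weak_entire_id_plus_funpow:
  fixes B :: "'a::chilbert_space \<Rightarrow> 'a"
  assumes "bounded_clinear B" "weak_entire f d"
  shows "weak_entire (\<lambda>z. (id_plus (z * c) B ^^ k) (f z)) (d + (of_nat k * c) *\<^sub>C B (f 0))"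
proof (induction k)
  case (Suc k)
  show ?case
    using weak_entire_id_plus[OF assms(1) Suc, of c]
    by (simp add: add.assoc distrib_right scaleC_add_left) (simp add: add_ac)
qed (use assms in simp)

section \<open>Norm estimates for powers of operators near the identity\<close>

lemma funpow_commute_apply:
  assumes "\<And>x. f (g x) = g (f x)"
  shows "(f ^^ m) (g x) = g ((f ^^ m) x)"
  by (induction m) (auto simp: assms)

lemma funpow_commute_funpow:
  assumes "\<And>x. f (g x) = g (f x)"
  shows "(f ^^ m) ((g ^^ m) x) = ((\<lambda>x. f (g x)) ^^ m) x"
proof (induction m arbitrary: x)
  case (Suc m)
  have "(f ^^ Suc m) ((g ^^ Suc m) x) = f (g ((f ^^ m) ((g ^^ m) x)))"
    by (simp add: funpow_commute_apply[of f g, OF assms])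
  then show ?case by (simp add: Suc)
qed simp

text \<open>Each further application of \<open>e\<close> adds an error of at most
  \<open>\<delta> * (1 + \<delta>) ^ m\<close> times \<open>norm x\<close>, and these errors form a
  geometric sum.\<close>

lemma funpow_near_id:
  fixes e :: "'a::real_normed_vector \<Rightarrow> 'a"
  assumes "\<And>x y. e (x - y) = e x - e y" "\<And>x. norm (x - e x) \<le> \<delta> * norm x" "\<delta> \<ge> 0"
  shows "norm (x - (e ^^ m) x) \<le> ((1 + \<delta>) ^ m - 1) * norm x"
proof (induction m)
  case (Suc m)
  have bound: "norm (e x) \<le> (1 + \<delta>) * norm x" for x
    using norm_triangle_ineq4[of x "x - e x"] assms(2)[of x] by (simp add: algebra_simps)
  have "norm (x - (e ^^ Suc m) x) \<le> norm (x - (e ^^ m) x) + norm ((e ^^ m) x - e ((e ^^ m) x))"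
    using norm_triangle_ineq[of "x - (e ^^ m) x" "(e ^^ m) x - e ((e ^^ m) x)"] by simp
  also have "\<dots> \<le> ((1 + \<delta>) ^ m - 1) * norm x + \<delta> * norm ((e ^^ m) x)"
    by (intro add_mono Suc assms)
  also have "\<dots> \<le> ((1 + \<delta>) ^ m - 1) * norm x + \<delta> * ((1 + \<delta>) ^ m * norm x)"
    using funpow_norm_le[of e, OF bound] assms(3) by (intro add_mono mult_left_mono) auto
  finally show ?case by (simp add: algebra_simps)
qed simp

lemma norm_id_plus_le:
  assumes "\<And>x. norm (B x) \<le> K * norm x"
  shows "norm (id_plus a B x) \<le> (1 + cmod a * K) * norm x"
proof -
  have "norm (id_plus a B x) \<le> norm x + cmod a * norm (B x)"
    unfolding id_plus_def using norm_triangle_ineq[of x "a *\<^sub>C B x"] by (simp add: norm_scaleC)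
  also have "\<dots> \<le> norm x + cmod a * (K * norm x)"
    by (intro add_mono mult_left_mono assms) auto
  finally show ?thesis by (simp add: algebra_simps)
qed

text \<open>The first-order term of the product is skew-adjoint, so it contributes to the norm only at
  second order.\<close>

lemma norm_id_plus_adjoint_id_plus_le:
  fixes B N :: "'a::complex_inner \<Rightarrow> 'a"
  assumes N: "bounded_clinear N" and B: "bounded_clinear B"
    and adj: "\<And>x y. cinner (N x) y = cinner x (B y)"
    and bN: "\<And>x. norm (N x) \<le> K * norm x" and bB: "\<And>x. norm (B x) \<le> K * norm x"
    and K: "K \<ge> 0"
  shows "norm (id_plus a B (id_plus (- cnj a) N x)) \<le> (1 + 3 * (cmod a * K)\<^sup>2) * norm x"
proof -
  note linN = bounded_clinearD[OF N] and linB = bounded_clinearD[OF B]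
  define r where "r = cmod a * K"
  have r: "r \<ge> 0" by (simp add: r_def K)
  define k where "k = a *\<^sub>C B x - cnj a *\<^sub>C N x"
  define q where "q = (a * cnj a) *\<^sub>C B (N x)"
  have eq: "id_plus a B (id_plus (- cnj a) N x) = x + k - q"
    by (simp add: id_plus_def k_def q_def linB scaleC_add_right scaleC_minus_left scaleC_minus_right
        scaleC_scaleC scaleC_diff_right)
  have aB: "norm (a *\<^sub>C B x) \<le> r * norm x"
    using mult_left_mono[OF bB[of x], of "cmod a"] by (simp add: norm_scaleC r_def mult_ac)
  have aN: "norm (cnj a *\<^sub>C N x) \<le> r * norm x"
    using mult_left_mono[OF bN[of x], of "cmod a"] by (simp add: norm_scaleC r_def mult_ac)
  have k: "norm k \<le> 2 * r * norm x"
    using norm_triangle_ineq4[of "a *\<^sub>C B x" "cnj a *\<^sub>C N x"] aB aN by (simp add: k_def)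
  have q: "norm q \<le> r\<^sup>2 * norm x"
  proof -
    have "norm (B (N x)) \<le> K * (K * norm x)"
      using bB[of "N x"] mult_left_mono[OF bN[of x] K] by linarith
    from mult_left_mono[OF this, of "cmod a * cmod a"] show ?thesis
      by (simp add: q_def norm_scaleC norm_mult r_def power2_eq_square mult_ac)
  qed
  \<comment> \<open>A number minus its conjugate, hence purely imaginary: \<open>k\<close> is
    orthogonal to \<open>x\<close> for \<open>inner\<close>, and Pythagoras applies to
    \<open>x + k\<close>.\<close>
  have "cinner k x = a * cnj (cinner x (B x)) - cnj a * cinner x (B x)"
    using cinner_commute[of "B x" x] adj[of x x]
    by (simp add: k_def cinner_diff_left cinner_scaleC_left)
  then have "inner k x = 0"
    by (simp add: inner_eq_Re_cinner)
  then have "(norm (x + k))\<^sup>2 = (norm x)\<^sup>2 + (norm k)\<^sup>2"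
    by (simp add: power2_norm_eq_inner inner_add_left inner_add_right inner_commute)
  also have "\<dots> \<le> (norm x)\<^sup>2 + (2 * r * norm x)\<^sup>2"
    using power_mono[OF k, of 2] by simp
  \<comment> \<open>Completing the square. The term \<open>q\<close> later adds one more
    \<open>r\<^sup>2\<close>, which gives the constant 3.\<close>
  also have "\<dots> \<le> ((1 + 2 * r\<^sup>2) * norm x)\<^sup>2"
  proof -
    have "((1 + 2 * r\<^sup>2) * norm x)\<^sup>2 = (norm x)\<^sup>2 + (2 * r * norm x)\<^sup>2 + 4 * (r\<^sup>2 * norm x)\<^sup>2"
      by (simp add: power2_eq_square algebra_simps)
    then show ?thesis by simp
  qed
  finally have "norm (x + k) \<le> (1 + 2 * r\<^sup>2) * norm x"
    by (rule power2_le_imp_le) simp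
  then show ?thesis
    using norm_triangle_ineq4[of "x + k" q] q unfolding eq r_def[symmetric] by (simp add: algebra_simps)
qed

text \<open>As \<open>m\<close> grows, the first power tends to 1,
  \<open>(1 + \<rho> / m) ^ (2 * m)\<close> stays bounded and the last factor tends to 0. The limit
  is therefore 1, and any bound above 1 would serve.\<close>

lemma growth_bound:
  fixes \<rho> :: real
  assumes "\<rho> > 0"
  obtains m :: nat where "m > 0"
    "(1 + 3 * (\<rho> / m)\<^sup>2) ^ (2 * m) + (1 + \<rho> / m) ^ (2 * m) * ((1 + (\<rho> / m)\<^sup>2) ^ m - 1) \<le> 2"
proof -
  have "(\<lambda>m::nat. (1 + 3 * (\<rho> / m)\<^sup>2) ^ (2 * m) +
      (1 + \<rho> / m) ^ (2 * m) * ((1 + (\<rho> / m)\<^sup>2) ^ m - 1)) \<longlonglongrightarrow> 1"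
    using assms by real_asymp
  then have "\<forall>\<^sub>F m::nat in sequentially. (1 + 3 * (\<rho> / m)\<^sup>2) ^ (2 * m) +
      (1 + \<rho> / m) ^ (2 * m) * ((1 + (\<rho> / m)\<^sup>2) ^ m - 1) < 2"
    by (rule order_tendstoD) simp
  then have "\<forall>\<^sub>F m::nat in sequentially. m > 0 \<and> (1 + 3 * (\<rho> / m)\<^sup>2) ^ (2 * m) +
      (1 + \<rho> / m) ^ (2 * m) * ((1 + (\<rho> / m)\<^sup>2) ^ m - 1) < 2"
    using eventually_gt_at_top[of 0] by eventually_elim simp
  then show thesis
    using that by (force simp: eventually_sequentially)
qed

text \<open>The powers of \<open>s\<close> alone have only an exponential bound. The factors
  \<open>t a = 1 - cnj a N\<close> commute with \<open>A\<close>, so \<open>t a ^^ m\<close> and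
  \<open>t (- a) ^^ m\<close> can be inserted on the two sides of \<open>A\<close>; there each
  \<open>s\<close> joins a \<open>t\<close> into a nearly unitary product, which gives the first
  summand. The second summand pays for the inserted pair not being exactly the identity.\<close>

lemma norm_id_plus_conjugate_le:
  fixes A B N :: "'a::complex_inner \<Rightarrow> 'a"
  assumes N: "bounded_clinear N" and B: "bounded_clinear B" and A: "bounded_clinear A"
    and adj: "\<And>x y. cinner (N x) y = cinner x (B y)"
    and bN: "\<And>x. norm (N x) \<le> K * norm x" and bB: "\<And>x. norm (B x) \<le> K * norm x"
    and K: "K \<ge> 0" and bA: "\<And>x. norm (A x) \<le> \<kappa> * norm x" and \<kappa>: "\<kappa> \<ge> 0"
    and NB: "\<And>x. N (B x) = B (N x)" and NA: "\<And>x. N (A x) = A (N x)"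
  defines "s \<equiv> \<lambda>a. id_plus a B"
  shows "norm ((s a ^^ m) (A ((s (- a) ^^ m) x))) \<le>
    ((1 + 3 * (cmod a * K)\<^sup>2) ^ (2 * m) +
     (1 + cmod a * K) ^ (2 * m) * ((1 + (cmod a * K)\<^sup>2) ^ m - 1)) * \<kappa> * norm x"
proof -
  note linN = bounded_clinearD[OF N] and linB = bounded_clinearD[OF B]
    and linA = bounded_clinearD[OF A]
  define t where "t a = id_plus (- cnj a) N" for a
  define r where "r = cmod a * K"
  have r: "r \<ge> 0" by (simp add: r_def K)
  have st: "s a (t b x) = t b (s a x)" for a b x
    by (simp add: s_def t_def id_plus_def linN linB scaleC_add_right scaleC_scaleC NB add_ac mult_ac)
  have tt: "t a (t b x) = t b (t a x)" for a b x
    by (simp add: t_def id_plus_def linN scaleC_add_right scaleC_scaleC add_ac mult_ac)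
  have tA: "t a (A x) = A (t a x)" for a x
    by (simp add: t_def id_plus_def linA NA)
  have lin_s: "bounded_clinear (s a ^^ m)" for a m
    unfolding s_def by (intro bounded_clinear_funpow bounded_clinear_id_plus B)
  \<comment> \<open>The inserted pair: its first-order terms cancel, so \<open>e\<close> differs
    from the identity only by order \<open>r\<^sup>2\<close>.\<close>
  define e where "e = (\<lambda>x. t a (t (- a) x))"
  define y where "y = (s (- a) ^^ m) x"
  have e_eq: "e x = x - (cnj a * cnj a) *\<^sub>C N (N x)" for x
    by (simp add: e_def t_def id_plus_def linN scaleC_add_right scaleC_scaleC scaleC_minus_left
        scaleC_minus_right)
  have near: "norm (x - e x) \<le> r\<^sup>2 * norm x" for x
  proof -
    have "norm (N (N x)) \<le> K * (K * norm x)"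
      using bN[of "N x"] mult_left_mono[OF bN[of x] K] by linarith
    from mult_left_mono[OF this, of "cmod a * cmod a"] show ?thesis
      by (simp add: e_eq norm_scaleC norm_mult r_def power2_eq_square mult_ac)
  qed
  have e_diff: "e (x - y) = e x - e y" for x y
    by (simp add: e_eq linN scaleC_add_right scaleC_diff_right)
  have s_le: "norm ((s b ^^ m) x) \<le> (1 + r) ^ m * norm x" if "cmod b = cmod a" for b x
    using norm_id_plus_le[of B, OF bB, of b] r that
    by (intro funpow_norm_le) (auto simp: s_def r_def)
  have st_le: "norm (((\<lambda>x. s b (t b x)) ^^ m) x) \<le> (1 + 3 * r\<^sup>2) ^ m * norm x"
    if "cmod b = cmod a" for b x
    using norm_id_plus_adjoint_id_plus_le[OF N B adj bN bB K, of b] r that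
    by (intro funpow_norm_le) (auto simp: s_def t_def r_def)
  have c1: "1 + r \<ge> 0" and c3: "1 + 3 * r\<^sup>2 \<ge> 0"
    using r by auto
  have "(s a ^^ m) (A ((e ^^ m) y)) = (s a ^^ m) (A ((t a ^^ m) ((t (- a) ^^ m) y)))"
    unfolding e_def using funpow_commute_funpow[of "t a" "t (- a)", OF tt] by simp
  also have "\<dots> = (s a ^^ m) ((t a ^^ m) (A ((t (- a) ^^ m) y)))"
    using funpow_commute_apply[of "t a" A, OF tA] by simp
  also have "\<dots> = ((\<lambda>x. s a (t a x)) ^^ m) (A (((\<lambda>x. s (- a) (t (- a) x)) ^^ m) x))"
    unfolding y_def
    using funpow_commute_funpow[of "s a" "t a", OF st]
      funpow_commute_funpow[of "t (- a)" "s (- a)", OF st[symmetric]] st by simp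
  finally have main_eq: "(s a ^^ m) (A ((e ^^ m) y)) = \<dots>" .
  have "norm ((s a ^^ m) (A ((e ^^ m) y)))
      \<le> (1 + 3 * r\<^sup>2) ^ m * norm (A (((\<lambda>x. s (- a) (t (- a) x)) ^^ m) x))"
    unfolding main_eq by (rule st_le) simp
  also have "\<dots> \<le> (1 + 3 * r\<^sup>2) ^ m * (\<kappa> * ((1 + 3 * r\<^sup>2) ^ m * norm x))"
    by (intro mult_left_mono order_trans[OF bA] st_le \<kappa> zero_le_power c3) simp
  finally have main: "norm ((s a ^^ m) (A ((e ^^ m) y))) \<le> (1 + 3 * r\<^sup>2) ^ (2 * m) * \<kappa> * norm x"
    unfolding mult_2 power_add by (simp add: mult_ac)
  \<comment> \<open>Cost of replacing \<open>y\<close> by \<open>(e ^^ m) y\<close>: both powers of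
    \<open>s\<close> get the crude bound \<open>(1 + r) ^ m\<close>, to be offset by the factor from
    \<open>funpow_near_id\<close>.\<close>
  have "norm ((s a ^^ m) (A (y - (e ^^ m) y)))
      \<le> (1 + r) ^ m * (\<kappa> * (((1 + r\<^sup>2) ^ m - 1) * ((1 + r) ^ m * norm x)))"
  proof (rule order_trans[OF s_le], simp, intro mult_left_mono order_trans[OF bA] \<kappa>)
    have "norm (y - (e ^^ m) y) \<le> ((1 + r\<^sup>2) ^ m - 1) * norm y"
      by (intro funpow_near_id e_diff near) simp
    also have "\<dots> \<le> ((1 + r\<^sup>2) ^ m - 1) * ((1 + r) ^ m * norm x)"
      unfolding y_def by (intro mult_left_mono s_le) (auto simp: one_le_power)
    finally show "norm (y - (e ^^ m) y) \<le> ((1 + r\<^sup>2) ^ m - 1) * ((1 + r) ^ m * norm x)" .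
  qed (use c1 in simp)
  then have err: "norm ((s a ^^ m) (A (y - (e ^^ m) y)))
      \<le> (1 + r) ^ (2 * m) * ((1 + r\<^sup>2) ^ m - 1) * \<kappa> * norm x"
    unfolding mult_2 power_add by (simp add: mult_ac)
  have "(s a ^^ m) (A y) = (s a ^^ m) (A ((e ^^ m) y)) + (s a ^^ m) (A (y - (e ^^ m) y))"
    by (simp add: linA flip: bounded_clinearD(1)[OF lin_s])
  then have "norm ((s a ^^ m) (A y))
      \<le> norm ((s a ^^ m) (A ((e ^^ m) y))) + norm ((s a ^^ m) (A (y - (e ^^ m) y)))"
    by (simp only: norm_triangle_ineq)
  also have "\<dots> \<le> (1 + 3 * r\<^sup>2) ^ (2 * m) * \<kappa> * norm x +
      (1 + r) ^ (2 * m) * ((1 + r\<^sup>2) ^ m - 1) * \<kappa> * norm x"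
    by (intro add_mono main err)
  finally show ?thesis
    unfolding y_def r_def by (simp only: distrib_right)
qed

theorem fuglede:
  fixes A N :: "'a::chilbert_space \<Rightarrow> 'a"
  assumes "normal_operator N" and A: "bounded_clinear A" and NA: "\<And>x. N (A x) = A (N x)"
  shows "cadjoint N (A x) = A (cadjoint N x)"
proof -
  have N: "bounded_clinear N" and NB: "N (cadjoint N x) = cadjoint N (N x)" for x
    using assms(1) by (auto simp: normal_operator_def fun_eq_iff)
  define B where "B = cadjoint N"
  note B = bounded_clinear_cadjoint[OF N, folded B_def]
    and adj = cinner_cadjoint[OF N, folded B_def]
  obtain K where K: "K > 0" and bN: "\<And>x. norm (N x) \<le> K * norm x"
    using bounded_clinear_pos_bound[OF N] by blast
  have bB: "norm (B x) \<le> K * norm x" for x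
    unfolding B_def by (intro cadjoint_norm_le N bN)
  obtain \<kappa> where \<kappa>: "\<kappa> > 0" and bA: "\<And>x. norm (A x) \<le> \<kappa> * norm x"
    using bounded_clinear_pos_bound[OF A] by blast
  \<comment> \<open>The commutator that has to vanish; it is the derivative at 0 of the map
    \<open>F\<close> below.\<close>
  define d where "d = B (A x) - A (B x)"
  have "cinner d y = 0" for y
  proof -
    \<comment> \<open>Bounds the pairing on each circle about 0. It does not depend on
      \<open>R\<close>, although the number \<open>m\<close> of factors does.\<close>
    define C where "C = 2 * \<kappa> * norm x * norm y"
    have bound: "cmod (cinner d y) \<le> C / R" if R: "R > 0" for R
    proof -
      have "R * K > 0" using R K by simp
      then obtain m :: nat where m: "m > 0" and m_bound:
        "(1 + 3 * (R * K / m)\<^sup>2) ^ (2 * m) +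
          (1 + R * K / m) ^ (2 * m) * ((1 + (R * K / m)\<^sup>2) ^ m - 1) \<le> 2"
        using growth_bound by metis
      \<comment> \<open>With this step size the \<open>m\<close> factors have total derivative
        \<open>B\<close> at 0.\<close>
      define c where "c = 1 / complex_of_nat m"
      define F where "F z = (id_plus (z * c) B ^^ m) (A ((id_plus (z * - c) B ^^ m) x))" for z
      have mc: "of_nat m * c = 1" using m by (simp add: c_def)
      have "weak_entire (\<lambda>z. (id_plus (z * - c) B ^^ m) x) (0 + (of_nat m * - c) *\<^sub>C B x)"
        by (rule weak_entire_id_plus_funpow[OF B weak_entire_const])
      note weak_entire_apply[OF A this]
      note weak_entire_id_plus_funpow[OF B this, where c = c and k = m]
      then have "weak_entire F d"
        by (simp add: F_def[abs_def] mc d_def scaleC_minus_left bounded_clinearD[OF A])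
      then have F: "(\<lambda>z. cinner (F z) y) holomorphic_on UNIV"
          "((\<lambda>z. cinner (F z) y) has_field_derivative cinner d y) (at 0)"
        by (auto simp: weak_entire_def)
      have "cmod ((deriv ^^ 1) (\<lambda>z. cinner (F z) y) 0) \<le> fact 1 * C / R ^ 1"
      proof (rule Cauchy_inequality)
        show "(\<lambda>z. cinner (F z) y) holomorphic_on ball 0 R"
          using F(1) holomorphic_on_subset by blast
        show "continuous_on (cball 0 R) (\<lambda>z. cinner (F z) y)"
          using F(1) holomorphic_on_imp_continuous_on continuous_on_subset by blast
        show "cmod (cinner (F z) y) \<le> C" if "cmod (0 - z) = R" for z
        proof -
          have zc: "cmod (z * c) * K = R * K / m"
            using that by (simp add: c_def norm_mult norm_divide)
          have "norm (F z) \<le> ((1 + 3 * (R * K / m)\<^sup>2) ^ (2 * m) +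
              (1 + R * K / m) ^ (2 * m) * ((1 + (R * K / m)\<^sup>2) ^ m - 1)) * \<kappa> * norm x"
            using norm_id_plus_conjugate_le[OF N B A adj bN bB _ bA _ _ NA,
                where a = "z * c" and m = m and x = x] K \<kappa> NB
            by (simp add: F_def zc B_def)
          also have "\<dots> \<le> 2 * \<kappa> * norm x"
            using \<kappa> by (intro mult_right_mono m_bound) auto
          finally have "norm (F z) * norm y \<le> C"
            unfolding C_def by (intro mult_right_mono) auto
          then show ?thesis using norm_cinner_le[of "F z" y] by linarith
        qed
      qed (use R in auto)
      then show ?thesis using DERIV_imp_deriv[OF F(2)] by simp
    qed
    have "cmod (cinner d y) \<le> 0"
    proof (rule tendsto_lowerbound)
      show "((\<lambda>R. C / R) \<longlongrightarrow> 0) at_top" by real_asymp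
      show "\<forall>\<^sub>F R in at_top. cmod (cinner d y) \<le> C / R"
        using eventually_gt_at_top[of 0] by eventually_elim (rule bound)
    qed simp
    then show ?thesis by simp
  qed
  then have "d = 0" by (simp add: cinner_ext[of d 0])
  then show ?thesis by (simp add: d_def B_def)
qed

section \<open>Polynomials of a positive operator\<close>

text \<open>The polynomial calculus \<open>p(M) x\<close> in Horner form, so that
  \<open>pCons\<close> unfolds by one application of \<open>M\<close>.\<close>

definition poly_op :: "complex poly \<Rightarrow> ('a::complex_inner \<Rightarrow> 'a) \<Rightarrow> 'a \<Rightarrow> 'a"
  where "poly_op p M x = fold_coeffs (\<lambda>a y. a *\<^sub>C x + M y) p 0"

context
  fixes M :: "'a::complex_inner \<Rightarrow> 'a"
  assumes M: "bounded_clinear M"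
begin

lemma poly_op_0 [simp]: "poly_op 0 M x = 0"
  by (simp add: poly_op_def)

lemma poly_op_pCons [simp]: "poly_op (pCons a p) M x = a *\<^sub>C x + M (poly_op p M x)"
  by (cases "p = 0 \<and> a = 0") (auto simp: poly_op_def bounded_clinearD[OF M])

lemma poly_op_add: "poly_op (p + q) M x = poly_op p M x + poly_op q M x"
  by (induction p q rule: poly_induct2) (simp_all add: bounded_clinearD[OF M] scaleC_add_left)

lemma poly_op_smult: "poly_op (smult c p) M x = c *\<^sub>C poly_op p M x"
  by (induction p) (simp_all add: bounded_clinearD[OF M] scaleC_add_right scaleC_scaleC)

lemma poly_op_diff: "poly_op (p - q) M x = poly_op p M x - poly_op q M x"
  using poly_op_add[of "p - q" q x] by simp

lemma poly_op_mult: "poly_op (p * q) M x = poly_op p M (poly_op q M x)"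
  by (induction p) (simp_all add: poly_op_add poly_op_smult)

lemma poly_op_monom: "poly_op (monom c n) M x = c *\<^sub>C (M ^^ n) x"
  by (induction n) (simp_all add: monom_0 monom_Suc bounded_clinearD[OF M])

lemma poly_op_sum: "poly_op (\<Sum>i\<in>I. p i) M x = (\<Sum>i\<in>I. poly_op (p i) M x)"
  by (induction I rule: infinite_finite_induct) (simp_all add: poly_op_add)

lemma bounded_clinear_poly_op: "bounded_clinear (poly_op p M)"
proof (induction p)
  case 0
  show ?case by (simp add: poly_op_def[abs_def] bounded_clinear_def)
next
  case (pCons a p)
  have "poly_op (pCons a p) M = (\<lambda>x. a *\<^sub>C x + (M \<circ> poly_op p M) x)"
    by auto
  then show ?case
    by (simp only:) (intro bounded_clinear_add bounded_clinear_scaleC bounded_clinear_id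
      bounded_clinear_compose M pCons.IH)
qed

lemma poly_op_symmetric:
  assumes sym: "\<And>x y. cinner (M x) y = cinner x (M y)" and "\<And>i. coeff p i \<in> \<real>"
  shows "cinner (poly_op p M x) y = cinner x (poly_op p M y)"
  using assms(2)
proof (induction p arbitrary: x y)
  case (pCons a p)
  \<comment> \<open>Multiplication by \<open>[:0, 1:]\<close> corresponds to applying
    \<open>M\<close>, so the claim is commutativity of polynomial multiplication.\<close>
  have comm: "M (poly_op p M x) = poly_op p M (M x)" for x
    using poly_op_mult[of "[:0, 1:]" p x] poly_op_mult[of p "[:0, 1:]" x]
    by (simp add: mult.commute[of p] bounded_clinearD[OF M] del: mult_pCons_left mult_pCons_right)
  have "cnj a = a"
    using pCons.prems[of 0] by (simp add: Reals_cnj_iff)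
  moreover have "cinner (poly_op p M x) y = cinner x (poly_op p M y)" for x y
    by (rule pCons.IH) (use pCons.prems[of "Suc _"] in simp)
  ultimately show ?case
    by (simp add: cinner_add_left cinner_add_right cinner_scaleC_left cinner_scaleC_right sym comm)
qed simp

section \<open>Spectral bounds for a positive operator\<close>

context
  fixes \<nu> :: real
  assumes sym: "\<And>x y. cinner (M x) y = cinner x (M y)"
    and pos: "\<And>x. inner (M x) x \<ge> 0"
    and bound: "\<And>x. norm (M x) \<le> \<nu> * norm x" and \<nu>: "\<nu> \<ge> 0"
begin

text \<open>The Rayleigh quotient \<open>t\<close> of \<open>x\<close> lies in
  \<open>{0..\<nu>}\<close>, and Cauchy-Schwarz bounds \<open>norm (M x - z *\<^sub>C x)\<close>
  below by \<open>cmod (z - of_real t) * norm x\<close>. So the distance from \<open>z\<close> to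
  the interval serves as \<open>\<delta>\<close>.\<close>

lemma linear_factor_bounded_below:
  assumes "z \<notin> complex_of_real ` {0..\<nu>}"
  obtains \<delta> where "\<delta> > 0" "\<And>x. \<delta> * norm x \<le> norm (M x - z *\<^sub>C x)"
proof
  let ?S = "complex_of_real ` {0..\<nu>}"
  have "closed ?S" "?S \<noteq> {}"
    using \<nu> by (auto intro!: compact_imp_closed compact_continuous_image continuous_intros)
  then show "infdist z ?S > 0"
    using assms by (simp add: infdist_pos_not_in_closed)
  fix x
  show "infdist z ?S * norm x \<le> norm (M x - z *\<^sub>C x)"
  proof (cases "x = 0")
    case False
    then have nx: "norm x > 0" by simp
    define r where "r = inner (M x) x"
    define t where "t = r / (norm x)\<^sup>2"
    have "r \<le> norm (M x) * norm x" unfolding r_def by (rule norm_cauchy_schwarz)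
    also have "\<dots> \<le> (\<nu> * norm x) * norm x" by (intro mult_right_mono bound) simp
    finally have "t \<in> {0..\<nu>}"
      using pos[of x] nx by (simp add: t_def r_def field_simps power2_eq_square)
    then have "infdist z ?S \<le> cmod (z - of_real t)"
      by (metis dist_norm image_eqI infdist_le)
    have "Im (cinner (M x) x) = 0"
      using arg_cong[OF cinner_commute[of "M x" x], of Im] by (simp add: sym)
    then have "cinner (M x) x = of_real r"
      by (simp add: complex_eq_iff r_def inner_eq_Re_cinner)
    then have "cinner (M x - z *\<^sub>C x) x = of_real ((norm x)\<^sup>2) * (of_real t - z)"
      using nx by (simp add: cinner_diff_left cinner_scaleC_left cinner_self t_def algebra_simps)
    then have "cmod (cinner (M x - z *\<^sub>C x) x) = (norm x)\<^sup>2 * cmod (z - of_real t)"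
      by (simp add: norm_mult norm_minus_commute norm_power)
    then have "(norm x)\<^sup>2 * cmod (z - of_real t) \<le> norm (M x - z *\<^sub>C x) * norm x"
      using norm_cinner_le by metis
    then have "norm x * cmod (z - of_real t) \<le> norm (M x - z *\<^sub>C x)"
      using nx by (simp add: power2_eq_square)
    moreover have "infdist z ?S * norm x \<le> cmod (z - of_real t) * norm x"
      by (rule mult_right_mono) (use \<open>infdist z ?S \<le> _\<close> in auto)
    ultimately show ?thesis by (simp add: mult.commute)
  qed simp
qed

text \<open>Roots are split off one at a time by the fundamental theorem of algebra. None lies in
  the interval, so each linear factor is bounded below and the constants multiply.\<close>

lemma poly_op_bounded_below:
  assumes "p \<noteq> 0" "\<And>t. t \<in> {0..\<nu>} \<Longrightarrow> poly p (of_real t) \<noteq> 0"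
  shows "\<exists>c>0. \<forall>x. c * norm x \<le> norm (poly_op p M x)"
  using assms
proof (induction "degree p" arbitrary: p rule: less_induct)
  case less
  show ?case
  proof (cases "degree p = 0")
    case True
    then obtain a where a: "p = [:a:]" by (rule degree_eq_zeroE)
    then show ?thesis
      using less.prems(1) bounded_clinearD(4)[OF M]
      by (intro exI[of _ "cmod a"]) (simp add: norm_scaleC)
  next
    case False
    then obtain z where z: "poly p z = 0"
      using fundamental_theorem_of_algebra[of p] constant_degree[of p] by auto
    then obtain q where q: "p = [:- z, 1:] * q"
      by (metis poly_eq_0_iff_dvd dvdE)
    have "q \<noteq> 0" using less.prems(1) q by auto
    then have "degree q < degree p"
      unfolding q by (subst degree_mult_eq) auto
    moreover have "poly q (of_real t) \<noteq> 0" if "t \<in> {0..\<nu>}" for t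
      using less.prems(2)[OF that] by (auto simp: q)
    ultimately obtain c where c: "c > 0" "\<And>x. c * norm x \<le> norm (poly_op q M x)"
      using less.hyps \<open>q \<noteq> 0\<close> by blast
    have "z \<notin> complex_of_real ` {0..\<nu>}"
      using less.prems(2) z by auto
    then obtain \<delta> where \<delta>: "\<delta> > 0" "\<And>x. \<delta> * norm x \<le> norm (M x - z *\<^sub>C x)"
      using linear_factor_bounded_below by blast
    have "\<delta> * c * norm x \<le> norm (poly_op p M x)" for x
    proof -
      have "\<delta> * c * norm x \<le> \<delta> * norm (poly_op q M x)"
        using mult_left_mono[OF c(2)[of x], of \<delta>] \<delta>(1) by (simp add: mult_ac)
      also have "\<dots> \<le> norm (M (poly_op q M x) - z *\<^sub>C poly_op q M x)" by (rule \<delta>)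
      also have "\<dots> = norm (poly_op p M x)"
        unfolding q poly_op_mult by (simp add: scaleC_minus_left bounded_clinearD[OF M])
      finally show ?thesis .
    qed
    then show ?thesis using c(1) \<delta>(1) by (intro exI[of _ "\<delta> * c"]) auto
  qed
qed

text \<open>Otherwise the square of the operator norm would be an approximate eigenvalue of the square
  of the operator, which is excluded by the previous lemma.\<close>

theorem norm_poly_op_le:
  assumes real_coeffs: "\<And>i. coeff p i \<in> \<real>" and \<epsilon>: "\<epsilon> \<ge> 0"
    and p: "\<And>t. t \<in> {0..\<nu>} \<Longrightarrow> cmod (poly p (of_real t)) \<le> \<epsilon>"
  shows "norm (poly_op p M x) \<le> \<epsilon> * norm x"
proof -
  define A where "A = poly_op p M"
  have lin: "bounded_clinear A" unfolding A_def by (rule bounded_clinear_poly_op)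
  define \<mu> where "\<mu> = onorm A"
  have A: "norm (A x) \<le> \<mu> * norm x" for x
    unfolding \<mu>_def by (intro onorm bounded_clinearD[OF lin])
  have "\<mu> \<le> \<epsilon>"
  proof (rule ccontr)
    assume "\<not> \<mu> \<le> \<epsilon>"
    then have \<mu>: "\<mu> > \<epsilon>" "\<mu> > 0" using \<epsilon> by auto
    \<comment> \<open>Nonzero on the interval, because \<open>p\<close> has modulus at most
      \<open>\<epsilon> < \<mu>\<close> there; hence \<open>A\<^sup>2 - \<mu>\<^sup>2\<close> is
      bounded below by some \<open>c\<close>.\<close>
    define r where "r = p * p - [:of_real (\<mu>\<^sup>2):]"
    have r: "poly r (of_real t) \<noteq> 0" if "t \<in> {0..\<nu>}" for t
    proof
      assume "poly r (of_real t) = 0"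
      then have "(poly p (of_real t))\<^sup>2 = of_real (\<mu>\<^sup>2)"
        by (simp add: r_def power2_eq_square)
      from arg_cong[OF this, of cmod] have "(cmod (poly p (of_real t)))\<^sup>2 = \<mu>\<^sup>2"
        by (simp add: norm_power)
      then have "cmod (poly p (of_real t)) = \<mu>" using \<mu>(2) by (simp add: power2_eq_iff_nonneg)
      then show False using p[OF that] \<mu>(1) by simp
    qed
    have "r \<noteq> 0" using r[of 0] \<nu> by auto
    then obtain c where c: "c > 0" "\<And>x. c * norm x \<le> norm (poly_op r M x)"
      using poly_op_bounded_below r by blast
    \<comment> \<open>Expanding the square of
      \<open>norm (A (A x) - \<mu>\<^sup>2 *\<^sub>R x)\<close>, with \<open>A\<close> symmetric,
      turns the lower bound \<open>c\<close> into a uniform improvement on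
      \<open>\<mu> * norm x\<close>.\<close>
    have sq: "(norm (A x))\<^sup>2 \<le> (\<mu>\<^sup>2 - c\<^sup>2 / \<mu>\<^sup>2) * (norm x)\<^sup>2" for x
    proof -
      have "poly_op r M x = A (A x) - \<mu>\<^sup>2 *\<^sub>R x"
        by (simp add: r_def poly_op_diff poly_op_mult A_def scaleR_scaleC bounded_clinearD[OF M])
      then have "(c * norm x)\<^sup>2 \<le> (norm (A (A x) - \<mu>\<^sup>2 *\<^sub>R x))\<^sup>2"
        using c(1) power_mono[OF c(2)[of x], of 2] by simp
      also have "\<dots> = (norm (A (A x)))\<^sup>2 - 2 * \<mu>\<^sup>2 * inner (A (A x)) x + \<mu>\<^sup>2 * \<mu>\<^sup>2 * (norm x)\<^sup>2"
        by (simp add: power2_norm_eq_inner inner_diff_left inner_diff_right inner_commute)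
      also have "inner (A (A x)) x = (norm (A x))\<^sup>2"
        using poly_op_symmetric[OF sym real_coeffs, of "A x" x]
        by (simp add: inner_eq_Re_cinner power2_norm_eq_inner A_def)
      also have "(norm (A (A x)))\<^sup>2 \<le> (\<mu> * norm (A x))\<^sup>2"
        by (intro power_mono A) simp
      finally have "c\<^sup>2 * (norm x)\<^sup>2 \<le> \<mu>\<^sup>2 * (\<mu>\<^sup>2 * (norm x)\<^sup>2 - (norm (A x))\<^sup>2)"
        by (simp add: power_mult_distrib algebra_simps)
      then show ?thesis using \<mu>(2) by (simp add: field_simps)
    qed
    \<comment> \<open>The maximum with 0 makes \<open>b\<close> nonnegative without a discussion of
      the sign of the difference.\<close>
    define b where "b = sqrt (max 0 (\<mu>\<^sup>2 - c\<^sup>2 / \<mu>\<^sup>2))"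
    have "norm (A x) \<le> b * norm x" for x
    proof (rule power2_le_imp_le)
      have "(norm (A x))\<^sup>2 \<le> max 0 (\<mu>\<^sup>2 - c\<^sup>2 / \<mu>\<^sup>2) * (norm x)\<^sup>2"
        by (rule order_trans[OF sq]) (intro mult_right_mono, auto)
      then show "(norm (A x))\<^sup>2 \<le> (b * norm x)\<^sup>2"
        by (simp add: b_def power_mult_distrib)
    qed (simp add: b_def)
    then have "\<mu> \<le> b" unfolding \<mu>_def by (intro onorm_bound) (auto simp: b_def)
    moreover have "b < sqrt (\<mu>\<^sup>2)"
      unfolding b_def using \<mu>(2) c(1) by (intro real_sqrt_less_mono) auto
    ultimately show False using \<mu>(2) by simp
  qed
  then show ?thesis
    using A[of x] mult_right_mono[of \<mu> \<epsilon> "norm x"] by (simp add: A_def)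
qed

text \<open>By Weierstrass a real polynomial \<open>g\<close> approximates the \<open>n\<close>-th
  root on \<open>{0..\<nu> ^ n}\<close>. Then \<open>t - g (t ^ n)\<close> is uniformly small on
  \<open>{0..\<nu>}\<close>, and \<open>norm_poly_op_le\<close> carries this over to
  \<open>M\<close>.\<close>

theorem approx_by_powers:
  assumes n: "n \<ge> 1" and e: "e > 0"
  obtains a :: "nat \<Rightarrow> complex" and k
  where "\<And>x. norm (M x - (\<Sum>i\<le>k. a i *\<^sub>C (M ^^ (n * i)) x)) \<le> e * norm x"
proof -
  have "continuous_on {0..\<nu> ^ n} (root n)"
    by (intro continuous_intros)
  then obtain g where "real_polynomial_function g"
    and g: "\<And>s. s \<in> {0..\<nu> ^ n} \<Longrightarrow> \<bar>root n s - g s\<bar> < e"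
    using Stone_Weierstrass_real_polynomial_function[of "{0..\<nu> ^ n}" "root n" e] e
    by auto
  then obtain a k where g_eq: "g = (\<lambda>s. \<Sum>i\<le>k. a i * s ^ i)"
    by (auto simp: real_polynomial_function_iff_sum)
  define p where "p = [:0, 1:] - (\<Sum>i\<le>k. monom (complex_of_real (a i)) (n * i))"
  have "cmod (poly p (of_real t)) \<le> e" if t: "t \<in> {0..\<nu>}" for t
  proof -
    have "poly p (of_real t) = of_real (t - g (t ^ n))"
      by (simp add: p_def g_eq poly_sum poly_monom flip: power_mult)
    moreover have "t ^ n \<in> {0..\<nu> ^ n}" using t by (auto intro: power_mono)
    moreover have "root n (t ^ n) = t" using n t by (simp add: real_root_power_cancel)
    ultimately show ?thesis using g[of "t ^ n"] by (simp del: of_real_diff)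
  qed
  moreover have "coeff p i \<in> \<real>" for i
    by (auto simp: p_def coeff_sum coeff_pCons split: nat.split intro!: Reals_diff sum_in_Reals)
  ultimately have "norm (poly_op p M x) \<le> e * norm x" for x
    using e by (intro norm_poly_op_le) auto
  then show thesis
    by (intro that[of "\<lambda>i. of_real (a i)" k])
      (simp add: p_def poly_op_diff poly_op_sum poly_op_monom bounded_clinearD[OF M])
qed

end

end

section \<open>Spherically quasinormal tuples\<close>

text \<open>The operator in \<open>spherically_quasinormal\<close> as a constant of its own. For
  bounded entries it is \<open>C\<^sup>* C\<close> with \<open>C\<close> the column operator formed
  by \<open>As\<close>.\<close>

definition gram :: "('a::chilbert_space \<Rightarrow> 'a) list \<Rightarrow> 'a \<Rightarrow> 'a"
  where "gram As x = (\<Sum>A\<leftarrow>As. cadjoint A (A x))"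

lemma spherically_quasinormal_gram:
  "spherically_quasinormal As \<longleftrightarrow> (\<forall>A\<in>set As. \<forall>x. A (gram As x) = gram As (A x))"
  by (auto simp: spherically_quasinormal_def gram_def[abs_def] Let_def fun_eq_iff)

text \<open>Turns identities between gram operators into identities between sums of inner products,
  without adjoints of products.\<close>

lemma cinner_gram:
  assumes "\<forall>A\<in>set As. bounded_clinear A"
  shows "cinner (gram As x) y = (\<Sum>A\<leftarrow>As. cinner (A x) (A y))"
  unfolding gram_def cinner_sum_list_left using assms
  by (intro arg_cong[of _ _ sum_list] map_cong) (simp_all add: cinner_cadjoint')

lemma bounded_clinear_gram:
  assumes "\<forall>A\<in>set As. bounded_clinear A"
  shows "bounded_clinear (gram As)"
proof -
  have "bounded_clinear (\<lambda>x. \<Sum>A\<leftarrow>As. (cadjoint A \<circ> A) x)"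
    using assms
    by (intro bounded_clinear_sum_list)
      (blast intro: bounded_clinear_compose bounded_clinear_cadjoint)
  then show ?thesis by (simp add: gram_def[abs_def])
qed

lemma gram_symmetric:
  assumes "\<forall>A\<in>set As. bounded_clinear A"
  shows "cinner (gram As x) y = cinner x (gram As y)"
proof -
  have "cinner (gram As x) y = cnj (cinner (gram As y) x)"
    unfolding cinner_gram[OF assms]
    by (induction As) (auto simp: cinner_commute[symmetric])
  then show ?thesis using cinner_commute by metis
qed

lemma gram_nonneg:
  assumes "\<forall>A\<in>set As. bounded_clinear A"
  shows "inner (gram As x) x \<ge> 0"
proof -
  have "inner (gram As x) x = (\<Sum>A\<leftarrow>As. (norm (A x))\<^sup>2)"
    unfolding inner_eq_Re_cinner cinner_gram[OF assms]
    by (induction As) (auto simp: cinner_self)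
  then show ?thesis by (auto intro!: sum_list_nonneg)
qed

section \<open>Gram operators of products and powers of tuples\<close>

lemma tuple_comp_Nil [simp]: "tuple_comp [] Bs = []"
  by (simp add: tuple_comp_def)

lemma tuple_comp_Cons [simp]: "tuple_comp (A # As) Bs = map ((\<circ>) A) Bs @ tuple_comp As Bs"
  by (simp add: tuple_comp_def comp_def)

lemma set_tuple_comp: "set (tuple_comp As Bs) = {A \<circ> B |A B. A \<in> set As \<and> B \<in> set Bs}"
  by (auto simp: tuple_comp_def)

text \<open>The inner sum runs over \<open>As\<close>, so that for \<open>f\<close> built from inner
  products it can be collected into \<open>gram As\<close> at \<open>B x\<close>.\<close>

lemma sum_list_tuple_comp:
  fixes f :: "_ \<Rightarrow> 'b::comm_monoid_add"
  shows "(\<Sum>C\<leftarrow>tuple_comp As Bs. f C) = (\<Sum>B\<leftarrow>Bs. \<Sum>A\<leftarrow>As. f (A \<circ> B))"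
  by (induction As) (auto simp: sum_list_addf o_def)

lemma bounded_clinear_tuple_power:
  assumes "\<forall>A\<in>set As. bounded_clinear A"
  shows "\<forall>B\<in>set (tuple_power As n). bounded_clinear B"
  by (induction n)
    (use assms in \<open>auto simp: bounded_clinear_id set_tuple_comp intro!: bounded_clinear_compose\<close>)

lemma tuple_power_commute:
  assumes "\<forall>A\<in>set As. \<forall>x. A (M x) = M (A x)"
  shows "\<forall>B\<in>set (tuple_power As n). \<forall>x. B (M x) = M (B x)"
  by (induction n) (use assms in \<open>auto simp: set_tuple_comp\<close>)

text \<open>Summing \<open>(A B)\<^sup>* A B\<close> over \<open>A\<close> leaves
  \<open>B\<^sup>* G B\<close> with \<open>G = gram As\<close>, and \<open>comm\<close> moves
  \<open>G\<close> to the right of \<open>B\<close>.\<close>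

lemma gram_tuple_comp:
  assumes As: "\<forall>A\<in>set As. bounded_clinear A" and Bs: "\<forall>B\<in>set Bs. bounded_clinear B"
    and comm: "\<forall>B\<in>set Bs. \<forall>x. B (gram As x) = gram As (B x)"
  shows "gram (tuple_comp As Bs) x = gram Bs (gram As x)"
proof (rule cinner_ext)
  fix y
  have AB: "\<forall>C\<in>set (tuple_comp As Bs). bounded_clinear C"
    using As Bs by (auto simp: set_tuple_comp intro!: bounded_clinear_compose)
  have "cinner (gram (tuple_comp As Bs) x) y = (\<Sum>B\<leftarrow>Bs. cinner (gram As (B x)) (B y))"
    by (simp add: cinner_gram[OF AB] cinner_gram[OF As] sum_list_tuple_comp)
  also have "\<dots> = (\<Sum>B\<leftarrow>Bs. cinner (B (gram As x)) (B y))"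
    using comm by (intro arg_cong[of _ _ sum_list] map_cong) simp_all
  also have "\<dots> = cinner (gram Bs (gram As x)) y"
    by (simp add: cinner_gram[OF Bs])
  finally show "cinner (gram (tuple_comp As Bs) x) y = \<dots>" .
qed

lemma cadjoint_id: "cadjoint id x = x"
  by (rule cinner_ext) (simp add: cinner_cadjoint' bounded_clinear_id)

text \<open>Every product of entries commutes with \<open>gram As\<close>, so
  \<open>gram_tuple_comp\<close> peels off one factor at a time. At exponent 0 the tuple
  \<open>[id]\<close> makes both sides the identity.\<close>

lemma gram_tuple_power:
  assumes "\<forall>A\<in>set As. bounded_clinear A" "spherically_quasinormal As"
  shows "gram (tuple_power As n) x = (gram As ^^ n) x"
proof (induction n arbitrary: x)
  case 0
  show ?case by (simp add: gram_def cadjoint_id)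
next
  case (Suc n)
  have "\<forall>B\<in>set (tuple_power As n). \<forall>x. B (gram As x) = gram As (B x)"
    using assms(2) by (intro tuple_power_commute) (simp add: spherically_quasinormal_gram)
  then show ?case
    using gram_tuple_comp[OF assms(1) bounded_clinear_tuple_power[OF assms(1)]] Suc
    by (simp add: funpow_swap1)
qed

text \<open>An entry \<open>A\<close> commutes with each entry \<open>N\<close>, by Fuglede also
  with its adjoint, and hence with every summand of the gram operator.\<close>

lemma normal_tuple_spherically_quasinormal:
  assumes "normal_tuple Ns"
  shows "spherically_quasinormal Ns"
  unfolding spherically_quasinormal_gram
proof (intro ballI allI)
  fix A x assume A: "A \<in> set Ns"
  have lin: "bounded_clinear N" and normal: "normal_operator N" and comm: "A (N y) = N (A y)"
    if "N \<in> set Ns" for N y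
    using assms A that by (auto simp: normal_tuple_def normal_operator_def fun_eq_iff)
  have "A (gram Ns x) = (\<Sum>N\<leftarrow>Ns. A (cadjoint N (N x)))"
    unfolding gram_def
    by (induction Ns) (simp_all add: bounded_clinearD[OF lin[OF A]])
  also have "\<dots> = gram Ns (A x)"
    unfolding gram_def
  proof (intro arg_cong[of _ _ sum_list] map_cong refl)
    fix N assume N: "N \<in> set Ns"
    show "A (cadjoint N (N x)) = cadjoint N (N (A x))"
      using fuglede[OF normal[OF N] lin[OF A]] comm[OF N] by metis
  qed
  finally show "A (gram Ns x) = gram Ns (A x)" .
qed

text \<open>Intertwining by \<open>V\<close> passes to compositions, and both powers list their
  products in the same order.\<close>

lemma list_all2_tuple_power:
  assumes "list_all2 (\<lambda>A B. \<forall>x. B (V x) = V (A x)) Ts Ns"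
  shows "list_all2 (\<lambda>A B. \<forall>x. B (V x) = V (A x)) (tuple_power Ts n) (tuple_power Ns n)"
proof (induction n)
  case (Suc n)
  have "list_all2 (\<lambda>A B. \<forall>x. B (V x) = V (A x)) (tuple_comp Ts Ss) (tuple_comp Ns Ms)"
    if "list_all2 (\<lambda>A B. \<forall>x. B (V x) = V (A x)) Ss Ms" for Ss Ms
    using assms
  proof (induction rule: list_all2_induct)
    case (Cons A As B Bs)
    have "list_all2 (\<lambda>A B. \<forall>x. B (V x) = V (A x)) (map ((\<circ>) A) Ss) (map ((\<circ>) B) Ms)"
      using that Cons.hyps(1) by (auto simp: list_all2_conv_all_nth)
    then show ?case using Cons.IH by (simp add: list_all2_appendI)
  qed simp
  then show ?case using Suc by simp
qed simp

lemma sum_list_cinner_extension: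
  assumes "list_all2 (\<lambda>A B. \<forall>x. B (V x) = V (A x)) Ts Ns"
  shows "(\<Sum>A\<leftarrow>Ts. cinner (V (A x)) (V (A y))) = (\<Sum>N\<leftarrow>Ns. cinner (N (V x)) (N (V y)))"
  using assms by (induction rule: list_all2_induct) simp_all

text \<open>On the spectrum of a positive operator the identity is a uniform limit of polynomials in the
  \<open>n\<close>-th power, so \<open>M (V x)\<close> lies in the closure of the range of \<open>V\<close>, which is closed.\<close>

lemma range_invariant_of_power:
  fixes M :: "'k::chilbert_space \<Rightarrow> 'k" and V :: "'h::chilbert_space \<Rightarrow> 'k"
  assumes M: "bounded_clinear M" and sym: "\<And>x y. cinner (M x) y = cinner x (M y)"
    and pos: "\<And>x. inner (M x) x \<ge> 0"
    and V: "bounded_clinear V" and iso: "\<And>x y. cinner (V x) (V y) = cinner x y"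
    and W: "\<And>x y. cinner (V x) y = cinner x (W y)"
    and n: "n \<ge> 1" and inv: "\<And>x. (M ^^ n) (V x) = V (Q x)"
  shows "M (V x) = V (W (M (V x)))"
proof -
  have W_lin: "bounded_clinear W" by (rule bounded_clinear_adjoint[OF V W])
  \<comment> \<open>Thus \<open>V \<circ> W\<close> is the orthogonal projection onto the range of
    \<open>V\<close>, and the goal says that it fixes \<open>M (V x)\<close>.\<close>
  have WV: "W (V x) = x" for x
  proof (rule cinner_ext)
    show "cinner (W (V x)) y = cinner x y" for y
      using cinner_commute[of "W (V x)" y] cinner_commute[of x y] by (simp add: iso flip: W)
  qed
  have norm_V: "norm (V x) = norm x" for x
    by (simp add: norm_eq_sqrt_inner inner_eq_Re_cinner iso)
  have norm_W: "norm (W u) \<le> norm u" for u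
  proof -
    have "(norm (W u))\<^sup>2 = cmod (cinner (W u) (W u))" by (simp add: cinner_self norm_power)
    also have "\<dots> = cmod (cinner (V (W u)) u)" by (simp add: W)
    also have "\<dots> \<le> norm (V (W u)) * norm u" by (rule norm_cinner_le)
    finally have "norm (W u) * norm (W u) \<le> norm u * norm (W u)"
      by (simp add: norm_V power2_eq_square mult.commute)
    then show ?thesis
      by (cases "norm (W u) = 0") (auto dest: mult_right_le_imp_le)
  qed
  obtain \<nu> where \<nu>: "\<nu> > 0" "\<And>x. norm (M x) \<le> \<nu> * norm x"
    using bounded_clinear_pos_bound[OF M] by blast
  define u where "u = M (V x)"
  have "norm (u - V (W u)) \<le> e" if e: "e > 0" for e
  proof -
    \<comment> \<open>Makes \<open>2 * e' * (norm (V x) + 1)\<close> equal to \<open>e\<close>; the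
      summand 1 guards against \<open>V x = 0\<close>.\<close>
    define e' where "e' = e / (2 * (norm (V x) + 1))"
    have "e' > 0" using e by (simp add: e'_def add_nonneg_pos)
    then obtain a :: "nat \<Rightarrow> complex" and k where
      approx: "norm (M (V x) - (\<Sum>i\<le>k. a i *\<^sub>C (M ^^ (n * i)) (V x))) \<le> e' * norm (V x)"
      using approx_by_powers[OF M sym pos \<nu>(2) less_imp_le[OF \<nu>(1)] n] by metis
    have pow: "(M ^^ (n * i)) (V x) = V ((Q ^^ i) x)" for i
      by (induction i) (simp_all add: funpow_add inv)
    have V_sum: "V (\<Sum>i\<in>I. f i) = (\<Sum>i\<in>I. V (f i))" for I :: "nat set" and f
      by (intro linear_sum bounded_linear.linear bounded_clinearD[OF V])
    define w where "w = (\<Sum>i\<le>k. a i *\<^sub>C (Q ^^ i) x)"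
    have "(\<Sum>i\<le>k. a i *\<^sub>C (M ^^ (n * i)) (V x)) = V w"
      by (simp add: w_def V_sum pow bounded_clinearD[OF V])
    then have near: "norm (u - V w) \<le> e' * norm (V x)"
      using approx by (simp add: u_def)
    \<comment> \<open>The projection fixes \<open>V w\<close>, so its two occurrences
      cancel.\<close>
    have "u - V (W u) = (u - V w) - V (W (u - V w))"
      by (simp add: bounded_clinearD[OF V] bounded_clinearD[OF W_lin] WV)
    then have "norm (u - V (W u)) \<le> norm (u - V w) + norm (V (W (u - V w)))"
      by (metis norm_triangle_ineq4)
    also have "\<dots> \<le> 2 * norm (u - V w)"
      using norm_W[of "u - V w"] by (simp add: norm_V)
    also have "\<dots> \<le> 2 * e' * norm (V x)"
      using near by simp
    also have "\<dots> \<le> 2 * e' * (norm (V x) + 1)"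
      using \<open>e' > 0\<close> by simp
    also have "\<dots> = e"
      unfolding e'_def using norm_ge_zero[of "V x"] by (simp add: field_simps add_nonneg_eq_0_iff)
    finally show ?thesis .
  qed
  then have "norm (u - V (W u)) \<le> 0" by (rule field_le_epsilon[of _ 0, simplified])
  then show ?thesis by (simp add: u_def)
qed

theorem theorem2p8:
  fixes T :: "('h::chilbert_space \<Rightarrow> 'h) list" and d n :: nat
  assumes "d \<ge> 1"
    and "length T = d"
    and "\<forall>A\<in>set T. bounded_clinear A"
    and "subnormal_tuple TYPE('k::chilbert_space) T"
    and "n \<ge> 1"
    and "spherically_quasinormal (tuple_power T n)"
  shows "spherically_quasinormal T"
proof -
  obtain V :: "'h \<Rightarrow> 'k" and Ns :: "('k \<Rightarrow> 'k) list" where V: "bounded_clinear V"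
    and iso: "\<And>x y. cinner (V x) (V y) = cinner x y" and "length Ns = length T"
    and Ns: "normal_tuple Ns" and "\<And>k h. k < length T \<Longrightarrow> (Ns ! k) (V h) = V ((T ! k) h)"
    using assms(4) unfolding subnormal_tuple_def by metis
  then have lifts: "list_all2 (\<lambda>A B. \<forall>x. B (V x) = V (A x)) T Ns"
    by (simp add: list_all2_conv_all_nth)
  note T = assms(3)
  have Ns_lin: "\<forall>N\<in>set Ns. bounded_clinear N"
    using Ns by (auto simp: normal_tuple_def normal_operator_def)
  have Ns_sq: "spherically_quasinormal Ns"
    using Ns by (rule normal_tuple_spherically_quasinormal)
  obtain W where W: "\<And>x y. cinner (V x) y = cinner x (W y)"
    using adjoint_exists[OF V] by blast
  have W': "cinner (W u) x = cinner u (V x)" for u x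
    by (metis W cinner_commute)
  have norm_V: "norm (V x) = norm x" for x
    by (simp add: norm_eq_sqrt_inner inner_eq_Re_cinner iso)
  have inj_V: "x = y" if "V x = V y" for x y
    using norm_V[of "x - y"] that by (simp add: bounded_clinearD[OF V])

  define M where "M = gram Ns"
  note M_sym = gram_symmetric[OF Ns_lin, folded M_def]
  \<comment> \<open>Used with exponent \<open>n\<close>, where it describes \<open>Q\<close>, and
    with exponent 1, where it describes \<open>gram T\<close>.\<close>
  have compress: "gram (tuple_power T k) x = W ((M ^^ k) (V x))" for k x
  proof (rule cinner_ext)
    fix y
    note Tk = bounded_clinear_tuple_power[OF T, of k]
      and Nk = bounded_clinear_tuple_power[OF Ns_lin, of k]
    have "cinner (gram (tuple_power T k) x) y
        = (\<Sum>A\<leftarrow>tuple_power T k. cinner (V (A x)) (V (A y)))"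
      by (simp add: cinner_gram[OF Tk] iso)
    also have "\<dots> = cinner (gram (tuple_power Ns k) (V x)) (V y)"
      by (simp add: cinner_gram[OF Nk] sum_list_cinner_extension[OF list_all2_tuple_power[OF lifts]])
    also have "\<dots> = cinner (W ((M ^^ k) (V x))) y"
      by (simp add: gram_tuple_power[OF Ns_lin Ns_sq] M_def W')
    finally show "cinner (gram (tuple_power T k) x) y = \<dots>" .
  qed

  define R where "R = M ^^ n"
  define Q where "Q = gram (tuple_power T n)"
  have Q: "Q x = W (R (V x))" for x
    by (simp add: Q_def R_def compress)
  note Tn = bounded_clinear_tuple_power[OF T, of n]
    and Nn = bounded_clinear_tuple_power[OF Ns_lin, of n]
  have R: "R = gram (tuple_power Ns n)"
    using gram_tuple_power[OF Ns_lin Ns_sq, of n] by (auto simp: R_def M_def)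
  have R_comm: "B (R u) = R (B u)" if "B \<in> set (tuple_power Ns n)" for B u
  proof -
    have "B (M u) = M (B u)" for u
      using Ns_sq tuple_power_commute[of Ns M n] that
      by (simp add: spherically_quasinormal_gram M_def)
    then show ?thesis
      unfolding R_def by (metis funpow_commute_apply)
  qed
  have Q_comm: "A (Q x) = Q (A x)" if "A \<in> set (tuple_power T n)" for A x
    using assms(6) that by (simp add: spherically_quasinormal_gram Q_def)
  have R_V: "R (V x) = V (Q x)" for x
  proof -
    have lifts_n: "list_all2 (\<lambda>A B. \<forall>x. B (V x) = V (A x)) (tuple_power T n) (tuple_power Ns n)"
      by (rule list_all2_tuple_power[OF lifts])
    \<comment> \<open>The left sum is \<open>cinner (Q (Q x)) x\<close>. Moving \<open>Q\<close>
      past \<open>A\<close>, which is the hypothesis on the power of \<open>T\<close>, and then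
      \<open>R\<close> past \<open>B\<close> in the larger space turns it into
      \<open>cinner (R (R (V x))) (V x)\<close>.\<close>
    have "(\<Sum>A\<leftarrow>tuple_power T n. cinner (A (Q x)) (A x))
        = (\<Sum>A\<leftarrow>tuple_power T n. cinner (R (V (A x))) (V (A x)))"
      by (intro arg_cong[of _ _ sum_list] map_cong) (simp_all add: Q_comm, simp add: Q W')
    also have "\<dots> = (\<Sum>B\<leftarrow>tuple_power Ns n. cinner (R (B (V x))) (B (V x)))"
      using lifts_n by (induction rule: list_all2_induct) simp_all
    also have "\<dots> = (\<Sum>B\<leftarrow>tuple_power Ns n. cinner (B (R (V x))) (B (V x)))"
      by (intro arg_cong[of _ _ sum_list] map_cong) (simp_all add: R_comm)
    finally have "cinner (Q (Q x)) x = cinner (R (R (V x))) (V x)"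
      by (simp add: cinner_gram[OF Tn, folded Q_def] cinner_gram[OF Nn, folded R])
    then have "cinner (Q x) (Q x) = cinner (R (V x)) (R (V x))"
      by (simp add: gram_symmetric[OF Tn, folded Q_def] gram_symmetric[OF Nn, folded R])
    \<comment> \<open>\<open>V (Q x)\<close> is the orthogonal projection of \<open>R (V x)\<close>
      to the range of \<open>V\<close>; having the same norm, it equals
      \<open>R (V x)\<close>.\<close>
    moreover have "cinner (V (Q x)) (R (V x)) = cinner (Q x) (Q x)"
      by (simp add: W Q)
    moreover have "cinner (R (V x)) (V (Q x)) = cinner (Q x) (Q x)"
      by (simp add: Q flip: W')
    ultimately have "cinner (R (V x) - V (Q x)) (R (V x) - V (Q x)) = 0"
      by (simp add: cinner_diff_left cinner_diff_right iso)
    then show ?thesis by (simp add: cinner_self)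
  qed

  \<comment> \<open>By \<open>R_V\<close> the power \<open>M ^^ n\<close> leaves the range of
    \<open>V\<close> invariant, hence so does \<open>M\<close>, and its compression is
    \<open>gram T\<close> by \<open>compress\<close>.\<close>
  have M_V: "M (V x) = V (gram T x)" for x
  proof -
    have "M (V x) = V (W (M (V x)))"
    proof (rule range_invariant_of_power[OF _ M_sym _ V iso W assms(5)])
      show "bounded_clinear M" unfolding M_def by (rule bounded_clinear_gram[OF Ns_lin])
      show "inner (M u) u \<ge> 0" for u unfolding M_def by (rule gram_nonneg[OF Ns_lin])
      show "(M ^^ n) (V x) = V (Q x)" for x using R_V by (simp add: R_def)
    qed
    then show ?thesis
      using compress[of 1 x] unfolding tuple_power_1 by simp
  qed
  show ?thesis
    unfolding spherically_quasinormal_gram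
  proof (intro ballI allI)
    fix A x assume "A \<in> set T"
    then obtain i where i: "i < length T" "A = T ! i"
      by (auto simp: in_set_conv_nth)
    define N where "N = Ns ! i"
    have N: "N \<in> set Ns" "N (V x) = V (A x)" for x
      using i lifts by (auto simp: N_def list_all2_conv_all_nth)
    \<comment> \<open>The commutation holds for the extension; injectivity of \<open>V\<close>
      brings it back to \<open>T\<close>.\<close>
    have "V (A (gram T x)) = N (M (V x))"
      by (simp add: M_V N(2))
    also have "\<dots> = M (N (V x))"
      using Ns_sq N(1) by (simp add: spherically_quasinormal_gram M_def)
    also have "\<dots> = V (gram T (A x))"
      by (simp add: M_V N(2))
    finally show "A (gram T x) = gram T (A x)" by (rule inj_V)
  qed
qed

end
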